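(* Let $\mathcal{G}=\{G_1,\ldots,G_k\}$, $k\ge 2$, be a family of connected graphs on a common vertex set $V$ with $|V|\ge 3$. Then $\mathrm{Sd}_f(\mathcal{G})=1$ if and only if $\mathcal{G}$ is a collection of paths that share a common end-vertex (that is, every $G_i$ is a path with vertex set $V$, and there is a vertex $u\in V$ that has degree one in every $G_i$).
   Context: Graphs are finite, simple and undirected. $d_G(x,y)$ is the least number of edges on a path joining $x$ and $y$ in $G$ ($\infty$ if there is none). For distinct $x,y\in V(G)$, $R_G\{x,y\}=\{z\in V(G): d_G(x,z)\ne d_G(y,z)\}$. For a function $g$ on $V$ and $U\subseteq V$, $g(U)=\sum_{s\in U}g(s)$. A resolving function of $G$ is a function $g:V(G)\to[0,1]$ with $g(R_G\{x,y\})\ge 1$ for all distinct $x,y\in V(G)$. For a family $\mathcal{G}$ of graphs on a common vertex set $V$, a simultaneous resolving function is a function $g:V\to[0,1]$ that is a resolving function of every member of $\mathcal{G}$, and the simultaneous fractional dimension $\mathrm{Sd}_f(\mathcal{G})$ is the minimum of $g(V)$ over all simultaneous resolving functions $g$ of $\mathcal{G}$. An end-vertex is a vertex of degree one. *)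

theory Defs
  imports
    "HOL-Analysis.Function_Topology"
    "HOL-Library.Extended_Nat"
    "Graph_Theory.Graph_Theory"
begin

text \<open>
  A finite simple undirected graph is a \<^term>\<open>pair_graph\<close>: a finite, loop-free, symmetric digraph
  whose arcs are pairs of vertices. An edge \<open>xy\<close> is thus the two arcs \<open>(x, y)\<close> and \<open>(y, x)\<close>.
\<close>

text \<open>The infimum of the empty set is \<^term>\<open>\<infinity> :: enat\<close>.\<close>

definition gdist :: "'a pair_pre_digraph \<Rightarrow> 'a \<Rightarrow> 'a \<Rightarrow> enat" where
  "gdist G x y =
     (INF p \<in> {p. vpath p (with_proj G) \<and> hd p = x \<and> last p = y}. enat (vwalk_length p))"

definition resolving_nbhd :: "'a pair_pre_digraph \<Rightarrow> 'a \<Rightarrow> 'a \<Rightarrow> 'a set" where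
  "resolving_nbhd G x y = {z \<in> pverts G. gdist G x z \<noteq> gdist G y z}"

text \<open>
  Functions on the vertex set are represented by functions on the whole type whose values outside
  the vertex set are irrelevant.
\<close>

definition resolving_function :: "'a pair_pre_digraph \<Rightarrow> ('a \<Rightarrow> real) \<Rightarrow> bool" where
  "resolving_function G g \<longleftrightarrow>
     g \<in> pverts G \<rightarrow> {0..1} \<and>
     (\<forall>x\<in>pverts G. \<forall>y\<in>pverts G. x \<noteq> y \<longrightarrow> sum g (resolving_nbhd G x y) \<ge> 1)"

definition simultaneous_resolving_function ::
    "'a set \<Rightarrow> 'a pair_pre_digraph set \<Rightarrow> ('a \<Rightarrow> real) \<Rightarrow> bool" where
  "simultaneous_resolving_function V \<G> g \<longleftrightarrow>
     g \<in> V \<rightarrow> {0..1} \<and> (\<forall>G\<in>\<G>. resolving_function G g)"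

definition simultaneous_fractional_dim :: "'a set \<Rightarrow> 'a pair_pre_digraph set \<Rightarrow> real" where
  "simultaneous_fractional_dim V \<G> =
     (LEAST r. \<exists>g. simultaneous_resolving_function V \<G> g \<and> r = sum g V)"

definition path_graph :: "'a pair_pre_digraph \<Rightarrow> bool" where
  "path_graph G \<longleftrightarrow>
     (\<exists>p. p \<noteq> [] \<and> distinct p \<and> pverts G = set p \<and> parcs G = symcl (set (vwalk_arcs p)))"

text \<open>Every edge at \<open>u\<close> gives exactly one arc leaving \<open>u\<close>, so the degree is the out-degree.\<close>

definition end_vertex :: "'a pair_pre_digraph \<Rightarrow> 'a \<Rightarrow> bool" where
  "end_vertex G u \<longleftrightarrow> u \<in> pverts G \<and> out_degree (with_proj G) u = 1"

text \<open>
  The minimum defining \<^const>\<open>simultaneous_fractional_dim\<close> exists, so that \<^const>\<open>Least\<close> is meaningful.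
\<close>

lemma gdist_self: "x \<in> pverts G \<Longrightarrow> gdist G x x = 0"
proof -
  assume "x \<in> pverts G"
  then have "[x] \<in> {p. vpath p (with_proj G) \<and> hd p = x \<and> last p = x}"
    by (auto simp: vpath_def vwalk_def)
  then have "gdist G x x \<le> enat (vwalk_length [x])"
    unfolding gdist_def by (rule INF_lower)
  then show ?thesis by (simp add: zero_enat_def[symmetric])
qed

lemma gdist_eq_0D:
  assumes "gdist G x y = 0"
  shows "x = y"
proof (rule ccontr)
  assume "x \<noteq> y"
  have "1 \<le> gdist G x y"
    unfolding gdist_def
  proof (rule INF_greatest)
    fix p assume p: "p \<in> {p. vpath p (with_proj G) \<and> hd p = x \<and> last p = y}"
    then have "p \<noteq> []" by (auto simp: vpath_def vwalk_def)
    with p \<open>x \<noteq> y\<close> have "length p \<ge> 2"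
      by (cases p; cases "tl p") auto
    then show "1 \<le> enat (vwalk_length p)"
      by (simp add: one_enat_def)
  qed
  with assms show False by simp
qed

lemma left_in_resolving_nbhd:
  "x \<in> pverts G \<Longrightarrow> x \<noteq> y \<Longrightarrow> x \<in> resolving_nbhd G x y"
  unfolding resolving_nbhd_def using gdist_self[of x G] gdist_eq_0D[of G y x] by auto

lemma simultaneous_resolving_function_one:
  assumes "finite V" "\<And>G. G \<in> \<G> \<Longrightarrow> pverts G = V"
  shows "simultaneous_resolving_function V \<G> (\<lambda>_. 1)"
proof -
  have "1 \<le> card (resolving_nbhd G x y)" if "G \<in> \<G>" "x \<in> V" "x \<noteq> y" for G x y
  proof -
    have "finite (resolving_nbhd G x y)"
      using assms that by (auto simp: resolving_nbhd_def)
    moreover have "x \<in> resolving_nbhd G x y"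
      using assms that by (intro left_in_resolving_nbhd) auto
    ultimately show ?thesis
      by (metis One_nat_def Suc_leI card_gt_0_iff empty_iff)
  qed
  then show ?thesis
    using assms(2)
    by (fastforce simp: simultaneous_resolving_function_def resolving_function_def)
qed

lemma simultaneous_fractional_dim_is_minimum:
  assumes "finite V" "\<And>G. G \<in> \<G> \<Longrightarrow> pverts G = V"
  obtains g where "simultaneous_resolving_function V \<G> g"
    and "sum g V = simultaneous_fractional_dim V \<G>"
    and "\<And>h. simultaneous_resolving_function V \<G> h \<Longrightarrow>
           simultaneous_fractional_dim V \<G> \<le> sum h V"
proof -
  define K :: "('a \<Rightarrow> real) set" where "K = PiE UNIV (\<lambda>i. if i \<in> V then {0..1} else {0})"
  define C where "C = {g. \<forall>G\<in>\<G>. \<forall>x\<in>V. \<forall>y\<in>V. x \<noteq> y \<longrightarrow> (1::real) \<le> sum g (resolving_nbhd G x y)}"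
  have sub: "resolving_nbhd G x y \<subseteq> V" if "G \<in> \<G>" for G x y
    using assms(2)[OF that] by (auto simp: resolving_nbhd_def)
  have "compactin (product_topology (\<lambda>i. euclidean) UNIV) K"
    unfolding K_def by (subst compactin_PiE) auto
  then have compK: "compact K"
    by (simp add: euclidean_product_topology)
  have cont: "continuous_on UNIV (\<lambda>g::'a \<Rightarrow> real. sum g A)" for A
    by (intro continuous_on_sum continuous_on_product_coordinates)
  have "closed C"
  proof -
    have "C = (\<Inter>G\<in>\<G>. \<Inter>x\<in>V. \<Inter>y\<in>V - {x}. {g. 1 \<le> sum g (resolving_nbhd G x y)})"
      by (auto simp: C_def)
    moreover have "closed \<dots>"
      by (intro closed_INT ballI closed_Collect_le continuous_on_const cont)
    ultimately show ?thesis by simp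
  qed
  with compK have comp: "compact (K \<inter> C)" by (rule compact_Int_closed)
  have restr: "(\<lambda>v. if v \<in> V then h v else 0) \<in> K \<inter> C" 
    if "simultaneous_resolving_function V \<G> h" for h
  proof -
    have "sum (\<lambda>v. if v \<in> V then h v else 0) (resolving_nbhd G x y) = sum h (resolving_nbhd G x y)"
      if "G \<in> \<G>" for G x y
      using sub[OF that] by (intro sum.cong) auto
    then show ?thesis
      using that assms(2)
      by (auto simp: simultaneous_resolving_function_def resolving_function_def K_def C_def
          Pi_iff PiE_iff)
  qed
  have ofK: "simultaneous_resolving_function V \<G> g" if "g \<in> K \<inter> C" for g
  proof -
    have "g \<in> V \<rightarrow> {0..1}"
    proof
      fix v assume "v \<in> V"
      moreover have "g v \<in> (if v \<in> V then {0..1} else {0})"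
        using that unfolding K_def by blast
      ultimately show "g v \<in> {0..1}" by simp
    qed
    then show ?thesis
      using that assms(2)
      by (simp add: simultaneous_resolving_function_def resolving_function_def C_def)
  qed
  have "K \<inter> C \<noteq> {}"
    using restr[OF simultaneous_resolving_function_one[OF assms]] by auto
  then obtain g where g: "g \<in> K \<inter> C" and min: "\<And>h. h \<in> K \<inter> C \<Longrightarrow> sum g V \<le> sum h V"
    using continuous_attains_inf[OF comp _ continuous_on_subset[OF cont[of V] subset_UNIV]] by blast
  have least: "sum g V \<le> sum h V" if "simultaneous_resolving_function V \<G> h" for h
    using min[OF restr[OF that]] by simp
  have "simultaneous_fractional_dim V \<G> = sum g V"
    unfolding simultaneous_fractional_dim_def
    by (rule Least_equality) (use ofK[OF g] least in auto)
  with ofK[OF g] least show thesis by (intro that[of g]) auto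
qed

end

theory Submission
  imports Defs
begin

text \<open>
  A resolving function has weight at least one on every set \<open>R{x, y}\<close>, and these sets are contained
  in the vertex set. If its total weight is exactly one, then all of the weight already lies in each
  \<open>R{x, y}\<close>, so any vertex \<open>v\<close> of positive weight lies in all of them: \<open>v\<close> alone tells the
  vertices apart by their distances to it. Conversely, if such a \<open>v\<close> exists, its indicator function
  is a resolving function of weight one. Hence the simultaneous fractional dimension is one exactly
  when a single vertex resolves every member of the family
  (\<open>simultaneous_fractional_dim_eq_1_iff\<close>).

  What remains is a statement about one connected graph: the distances to \<open>v\<close> are pairwise different
  if and only if the graph is a path with end-vertex \<open>v\<close> (\<open>inj_gdist_iff_path_graph\<close>). Adjacent
  vertices differ by at most one in their distance to \<open>v\<close>, and every vertex at distance \<open>n + 1\<close> has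
  a neighbour at distance \<open>n\<close>. If each distance occurs only once, the distances therefore fill an
  initial segment \<open>0, \<dots>, n\<close>, and two vertices are adjacent exactly when their distances are
  consecutive; this is a path that starts at \<open>v\<close> (\<open>traces_if_inj_gdist\<close>). In the other direction,
  the distance to the first vertex of a path is the position on the path (\<open>gdist_traces\<close>).
\<close>

section \<open>Distances to a fixed vertex\<close>

text \<open>
  Cutting out the closed parts of a walk leaves a path that is no longer, so arbitrary walks bound
  the distance although only paths enter its definition. Walks can be extended by an arc at the front
  without checking that the new vertex is fresh.
\<close>

lemma gdist_le_vwalk_length:
  assumes "vwalk p (with_proj G)"
  shows "gdist G (hd p) (last p) \<le> enat (vwalk_length p)"
proof -
  have len: "length (vwalk_to_vpath q) \<le> length q" for q :: "'a list"
  proof (induction q rule: vwalk_to_vpath_induct3)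
    case (in_set x xs)
    then show ?case
      using length_dropWhile_le[of "\<lambda>y. y \<noteq> x" xs] by simp
  qed auto
  let ?q = "vwalk_to_vpath p"
  have "gdist G (hd p) (last p) \<le> enat (vwalk_length ?q)"
    unfolding gdist_def
    using vwalk_to_vpath_vpath[OF assms]
    by (intro INF_lower) (simp add: vwalk_to_vpath_hd vwalk_to_vpath_last)
  also have "\<dots> \<le> enat (vwalk_length p)"
    using len[of p] by simp
  finally show ?thesis .
qed

lemma gdist_attained:
  assumes "gdist G x v = enat n"
  obtains p where "vpath p (with_proj G)" "hd p = x" "last p = v" "vwalk_length p = n"
proof -
  let ?P = "{p. vpath p (with_proj G) \<and> hd p = x \<and> last p = v}"
  let ?L = "(\<lambda>p. enat (vwalk_length p)) ` ?P"
  have Inf: "Inf ?L = enat n"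
    using assms unfolding gdist_def .
  then have "?L \<noteq> {}"
    by (metis Inf_enat_def enat.distinct(1))
  then have "Inf ?L \<in> ?L"
    unfolding Inf_enat_def by (simp only: if_False) (meson LeastI_ex all_not_in_conv)
  then show thesis
    unfolding Inf using that by auto
qed

context pair_wf_digraph
begin

lemma gdist_le_Suc_gdist:
  assumes "(x, y) \<in> parcs G"
  shows "gdist G x v \<le> eSuc (gdist G y v)"
proof (cases "gdist G y v")
  case (enat n)
  then obtain p where p: "vpath p (with_proj G)" "hd p = y" "last p = v" "vwalk_length p = n"
    by (rule gdist_attained)
  then have "p \<noteq> []" by auto
  have "vwalk (x # p) (with_proj G)"
    using p assms by (intro vwalk_consI) (auto dest: in_arcsD1)
  from gdist_le_vwalk_length[OF this] show ?thesis
    using p \<open>p \<noteq> []\<close> enat by (cases p) (auto simp: eSuc_enat)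
qed simp

lemma gdist_Suc_descent:
  assumes "gdist G x v = enat (Suc n)"
  obtains y where "(x, y) \<in> parcs G" "gdist G y v = enat n"
proof -
  obtain p where p: "vpath p (with_proj G)" "hd p = x" "last p = v" "vwalk_length p = Suc n"
    using assms by (rule gdist_attained)
  then obtain y q where q: "p = x # y # q"
    by (cases p; cases "tl p") auto
  then have walk: "vwalk (y # q) (with_proj G)" and arc: "(x, y) \<in> parcs G"
    using p by (auto simp: vpath_def vwalk_def)
  have "gdist G y v \<le> enat n"
    using gdist_le_vwalk_length[OF walk] p q by simp
  moreover have "eSuc (enat n) \<le> eSuc (gdist G y v)"
    using gdist_le_Suc_gdist[OF arc, of v] assms by (simp add: eSuc_enat)
  ultimately show thesis
    using arc that by (metis antisym eSuc_ile_mono)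
qed

text \<open>
  The hypotheses say that \<open>f\<close> is the level function of a breadth-first search from \<open>v\<close>:
  descending along arcs reaches \<open>v\<close> from \<open>x\<close> in \<open>f x\<close> steps, and no walk loses more than one level
  per step.
\<close>

lemma gdist_eq_level:
  fixes f :: "'a \<Rightarrow> nat"
  assumes zero: "\<And>x. x \<in> pverts G \<Longrightarrow> f x = 0 \<longleftrightarrow> x = v"
    and step: "\<And>x y. (x, y) \<in> parcs G \<Longrightarrow> f x \<le> Suc (f y)"
    and descent: "\<And>x n. x \<in> pverts G \<Longrightarrow> f x = Suc n \<Longrightarrow> \<exists>y. (x, y) \<in> parcs G \<and> f y = n"
    and "x \<in> pverts G"
  shows "gdist G x v = enat (f x)"
proof (rule antisym)
  show "gdist G x v \<le> enat (f x)"
    using \<open>x \<in> pverts G\<close>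
  proof (induction "f x" arbitrary: x)
    case 0
    then show ?case using zero[of x] gdist_self[of x G] by simp
  next
    case (Suc n)
    then obtain y where y: "(x, y) \<in> parcs G" "f y = n" using descent by metis
    then have "gdist G y v \<le> enat n" using Suc by (auto dest: in_arcsD2)
    then have "eSuc (gdist G y v) \<le> enat (Suc n)" by (simp add: eSuc_enat[symmetric])
    then show ?case using gdist_le_Suc_gdist[OF y(1), of v] Suc(2) by (auto intro: order_trans)
  qed
next
  have walk: "f (hd p) \<le> f (last p) + vwalk_length p" if "vwalk p (with_proj G)" for p
    using that
  proof (induction p)
    case (Cons u w es)
    then show ?case using step[of u w] by auto
  qed auto
  show "enat (f x) \<le> gdist G x v"
    unfolding gdist_def
  proof (rule INF_greatest)
    fix p assume p: "p \<in> {p. vpath p (with_proj G) \<and> hd p = x \<and> last p = v}"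
    then have "v \<in> pverts G" by (auto simp: vpath_def vwalk_def)
    then show "enat (f x) \<le> enat (vwalk_length p)"
      using walk[of p] p zero[of v] by (auto simp: vpath_def)
  qed
qed

end

lemma (in pair_graph) gdist_finite:
  assumes "Digraph_Component.connected (with_proj G)" "x \<in> pverts G" "v \<in> pverts G"
  obtains n where "gdist G x v = enat n"
proof -
  have "x \<rightarrow>\<^sup>*\<^bsub>with_proj G\<^esub> v"
    using symmetric_connected_imp_strongly_connected[OF sym_arcs assms(1)] assms(2,3)
    by (auto simp: strongly_connected_def)
  then obtain p where "vpath p (with_proj G)" "hd p = x" "last p = v"
    using reachable_vpath_conv by blast
  then have "gdist G x v \<le> enat (vwalk_length p)"
    using gdist_le_vwalk_length[of p G] by auto
  then show thesis using that by (cases "gdist G x v") auto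
qed

section \<open>Paths and their end-vertices\<close>

lemma set_vwalk_arcs_nth: "set (vwalk_arcs p) = {(p ! i, p ! Suc i) | i. Suc i < length p}"
proof -
  have "vwalk_arcs p = zip p (tl p)"
    by (induction p rule: vwalk_arcs.induct) auto
  then have "set (vwalk_arcs p) = {(p ! i, tl p ! i) | i. Suc i < length p}"
    by (auto simp: set_zip)
  moreover have "tl p ! i = p ! Suc i" if "Suc i < length p" for i
    using that by (simp add: nth_tl)
  ultimately show ?thesis by auto
qed

text \<open>
  The list \<open>p\<close> witnesses that \<open>G\<close> is a path: it names all vertices in path order. Keeping the list
  explicit fixes one of the two directions of the path, and with it the end-vertex \<open>hd p\<close>.
\<close>

definition traces :: "'a list \<Rightarrow> 'a pair_pre_digraph \<Rightarrow> bool" where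
  "traces p G \<longleftrightarrow>
     p \<noteq> [] \<and> distinct p \<and> pverts G = set p \<and> parcs G = symcl (set (vwalk_arcs p))"

lemma path_graph_iff_traces: "path_graph G \<longleftrightarrow> (\<exists>p. traces p G)"
  by (simp add: path_graph_def traces_def)

lemma traces_rev:
  assumes "traces p G"
  shows "traces (rev p) G"
proof -
  have "symcl (set (vwalk_arcs (rev p))) = symcl (set (vwalk_arcs p))"
    by (auto simp: symcl_def set_vwalk_arcs_rev image_iff)
  then show ?thesis using assms by (simp add: traces_def)
qed

lemma traces_arc_iff:
  assumes "traces p G" "i < length p" "j < length p"
  shows "(p ! i, p ! j) \<in> parcs G \<longleftrightarrow> j = Suc i \<or> i = Suc j"
proof -
  have arc: "(p ! a, p ! b) \<in> set (vwalk_arcs p) \<longleftrightarrow> b = Suc a"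
    if "a < length p" "b < length p" for a b
  proof -
    have "(p ! a, p ! b) \<in> set (vwalk_arcs p) \<longleftrightarrow>
        (\<exists>c. Suc c < length p \<and> p ! a = p ! c \<and> p ! b = p ! Suc c)"
      by (auto simp: set_vwalk_arcs_nth)
    also have "\<dots> \<longleftrightarrow> b = Suc a"
      using that assms(1) by (auto simp: traces_def nth_eq_iff_index_eq dest: Suc_lessD)
    finally show ?thesis .
  qed
  have "(p ! i, p ! j) \<in> parcs G \<longleftrightarrow>
      (p ! i, p ! j) \<in> set (vwalk_arcs p) \<or> (p ! j, p ! i) \<in> set (vwalk_arcs p)"
    using assms(1) by (auto simp: traces_def symcl_def image_iff)
  then show ?thesis
    using arc assms(2,3) by simp
qed

lemma traces_out_arcs:
  assumes "traces p G" "i < length p"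
  shows "out_arcs (with_proj G) (p ! i) =
    (\<lambda>j. (p ! i, p ! j)) ` {j. j < length p \<and> (j = Suc i \<or> i = Suc j)}"
proof -
  let ?J = "{j. j < length p \<and> (j = Suc i \<or> i = Suc j)}"
  have snd: "snd e \<in> set p" if "e \<in> parcs G" for e
    using that assms(1)
    by (auto simp: traces_def symcl_def dest!: arcs_in_vwalk_arcs)
  show ?thesis
  proof (rule subset_antisym; rule subsetI)
    fix e assume "e \<in> out_arcs (with_proj G) (p ! i)"
    then have e: "e \<in> parcs G" "fst e = p ! i" by auto
    with snd obtain j where j: "j < length p" "snd e = p ! j"
      by (metis in_set_conv_nth)
    with e have "e = (p ! i, p ! j)" by (simp add: prod_eq_iff)
    moreover have "j \<in> ?J"
      using e(1) j(1) traces_arc_iff[OF assms j(1)] \<open>e = _\<close> by simp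
    ultimately show "e \<in> (\<lambda>j. (p ! i, p ! j)) ` ?J" by (rule image_eqI)
  next
    fix e assume "e \<in> (\<lambda>j. (p ! i, p ! j)) ` ?J"
    then obtain j where "e = (p ! i, p ! j)" "j < length p" "j = Suc i \<or> i = Suc j" by blast
    with traces_arc_iff[OF assms, of j] show "e \<in> out_arcs (with_proj G) (p ! i)" by simp
  qed
qed

lemma traces_end_vertex_iff:
  assumes "traces p G" "i < length p" "length p \<ge> 2"
  shows "end_vertex G (p ! i) \<longleftrightarrow> i = 0 \<or> Suc i = length p"
proof -
  let ?J = "{j. j < length p \<and> (j = Suc i \<or> i = Suc j)}"
  have "inj_on (\<lambda>j. (p ! i, p ! j)) ?J"
    using assms(1) by (intro inj_onI) (simp add: traces_def nth_eq_iff_index_eq)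
  then have "out_degree (with_proj G) (p ! i) = card ?J"
    unfolding out_degree_def traces_out_arcs[OF assms(1,2)] by (rule card_image)
  moreover have "?J = (if Suc i < length p then {Suc i} else {}) \<union> (if i = 0 then {} else {i - 1})"
    using assms(2) by (cases i) auto
  moreover have "p ! i \<in> pverts G"
    using assms by (simp add: traces_def)
  ultimately show ?thesis
    using assms(2,3) by (simp add: end_vertex_def)
qed

text \<open>
  An end-vertex is the first or the last vertex of the list, and reversing the list exchanges the two.
  On a single vertex the degree is zero, which is why two vertices are required.
\<close>

lemma path_graph_end_vertex_iff_traces:
  assumes "card (pverts G) \<ge> 2"
  shows "path_graph G \<and> end_vertex G v \<longleftrightarrow> (\<exists>p. traces p G \<and> hd p = v)"
proof
  assume G: "path_graph G \<and> end_vertex G v"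
  then obtain p where p: "traces p G" by (auto simp: path_graph_iff_traces)
  then have len: "length p \<ge> 2" using assms by (simp add: traces_def distinct_card)
  have "v \<in> set p" using G p by (auto simp: end_vertex_def traces_def)
  then obtain i where i: "i < length p" "v = p ! i" by (metis in_set_conv_nth)
  with G traces_end_vertex_iff[OF p _ len] have "i = 0 \<or> Suc i = length p" by simp
  moreover have "p \<noteq> []" "i = length p - 1" if "Suc i = length p"
    using that by auto
  ultimately have "v = hd p \<or> v = hd (rev p)"
    using i by (auto simp: hd_conv_nth hd_rev last_conv_nth)
  then show "\<exists>p. traces p G \<and> hd p = v"
    using p traces_rev by blast
next
  assume "\<exists>p. traces p G \<and> hd p = v"
  then obtain p where p: "traces p G" "hd p = v" by blast
  then have len: "length p \<ge> 2" using assms by (simp add: traces_def distinct_card)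
  with p traces_end_vertex_iff[OF p(1), of 0] show "path_graph G \<and> end_vertex G v"
    by (auto simp: path_graph_iff_traces hd_conv_nth simp flip: length_greater_0_conv)
qed

section \<open>A single vertex that resolves a connected graph\<close>

text \<open>
  The position on the path changes by one along every arc and vanishes only at the first vertex, so
  it is the level function of that vertex.
\<close>

lemma (in pair_graph) gdist_traces:
  assumes "traces p G" "i < length p"
  shows "gdist G (p ! i) (hd p) = enat i"
proof -
  let ?n = "length p"
  define f where "f = the_inv_into {..<?n} ((!) p)"
  have inj: "inj_on ((!) p) {..<?n}"
    using assms(1) by (auto simp: traces_def intro: inj_on_nth)
  have f: "f (p ! j) = j" if "j < ?n" for j
    unfolding f_def using inj that by (simp add: the_inv_into_f_f)
  have index: "\<exists>j<?n. x = p ! j" if "x \<in> pverts G" for x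
    using that assms(1) by (auto simp: traces_def in_set_conv_nth)
  have "gdist G (p ! i) (hd p) = enat (f (p ! i))"
  proof (rule gdist_eq_level)
    show "f x = 0 \<longleftrightarrow> x = hd p" if "x \<in> pverts G" for x
      using index[OF that] f assms(1) by (auto simp: traces_def hd_conv_nth)
    show "f x \<le> Suc (f y)" if "(x, y) \<in> parcs G" for x y
      using that index[OF in_arcsD1[OF that]] index[OF in_arcsD2[OF that]] f
        traces_arc_iff[OF assms(1)] by auto
    show "\<exists>y. (x, y) \<in> parcs G \<and> f y = n" if "x \<in> pverts G" "f x = Suc n" for x n
      using index[OF that(1)] that(2) f traces_arc_iff[OF assms(1)] by (metis Suc_lessD)
    show "p ! i \<in> pverts G"
      using assms by (simp add: traces_def)
  qed
  then show ?thesis using f assms(2) by simp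
qed

text \<open>
  Connectedness makes the distances to \<open>v\<close> finite, and the descent property makes the set of their
  values downward closed. Listing the vertices by increasing distance then gives the path. The crucial
  point is that a vertex at distance \<open>n + 1\<close> is adjacent to some vertex at distance \<open>n\<close>, which by
  injectivity can only be its predecessor in the list.
\<close>

lemma (in pair_graph) traces_if_inj_gdist:
  assumes conn: "Digraph_Component.connected (with_proj G)" and v: "v \<in> pverts G"
    and inj: "inj_on (\<lambda>x. gdist G x v) (pverts G)"
  obtains p where "traces p G" "hd p = v"
proof -
  let ?V = "pverts G"
  define f where "f x = the_enat (gdist G x v)" for x
  have f: "gdist G x v = enat (f x)" if "x \<in> ?V" for x
    using gdist_finite[OF conn that v] unfolding f_def by (metis the_enat.simps)
  have inj_f: "inj_on f ?V"
    using inj f by (auto simp: inj_on_def)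
  have descent: "\<exists>y. (x, y) \<in> parcs G \<and> f y = n" if "x \<in> ?V" "f x = Suc n" for x n
  proof -
    have "gdist G x v = enat (Suc n)" using f that by simp
    then obtain y where "(x, y) \<in> parcs G" "gdist G y v = enat n" by (rule gdist_Suc_descent)
    then show ?thesis using f in_arcsD2 by fastforce
  qed
  have step: "f x \<le> Suc (f y)" if "(x, y) \<in> parcs G" for x y
    using gdist_le_Suc_gdist[OF that, of v] f in_arcsD1[OF that] in_arcsD2[OF that]
    by (simp add: eSuc_enat)
  have sym: "(y, x) \<in> parcs G" if "(x, y) \<in> parcs G" for x y
    using that sym_arcs by (auto simp: symmetric_def sym_def)
  have arc_iff: "(x, y) \<in> parcs G \<longleftrightarrow> f y = Suc (f x) \<or> f x = Suc (f y)"
    if "x \<in> ?V" "y \<in> ?V" for x y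
  proof
    assume arc: "(x, y) \<in> parcs G"
    then have "f x \<noteq> f y"
      using inj_f that pair_no_loops[OF arc] by (auto dest: inj_onD)
    then show "f y = Suc (f x) \<or> f x = Suc (f y)"
      using step[OF arc] step[OF sym[OF arc]] by linarith
  next
    have "(x, y) \<in> parcs G" if "x \<in> ?V" "y \<in> ?V" "f x = Suc (f y)" for x y
      using descent[OF that(1,3)] inj_onD[OF inj_f] that(2) in_arcsD2 by metis
    then show "(x, y) \<in> parcs G" if "f y = Suc (f x) \<or> f x = Suc (f y)"
      using that \<open>x \<in> ?V\<close> \<open>y \<in> ?V\<close> sym by blast
  qed
  have down: "n \<in> f ` ?V" if "n \<le> f x" "x \<in> ?V" for n x
    using that
  proof (induction "f x - n" arbitrary: x)
    case 0
    then show ?case using le_antisym by fastforce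
  next
    case (Suc m)
    then obtain k where k: "f x = Suc k" "m = k - n" "n \<le> k"
      by (cases "f x") (auto simp: Suc_diff_le)
    with descent[OF Suc.prems(2) k(1)] Suc.hyps(1) in_arcsD2 show ?case by metis
  qed
  have fin: "finite (f ` ?V)" "f ` ?V \<noteq> {}"
    using v pair_finite_verts by auto
  define N where "N = Suc (Max (f ` ?V))"
  have range: "f ` ?V = {..<N}"
  proof
    show "f ` ?V \<subseteq> {..<N}"
      using fin by (simp add: N_def subset_iff less_Suc_eq_le)
    obtain x where "x \<in> ?V" "f x = Max (f ` ?V)"
      using Max_in[OF fin] by auto
    then show "{..<N} \<subseteq> f ` ?V"
      using down[of _ x] by (auto simp: N_def)
  qed
  define g where "g = the_inv_into ?V f"
  have g: "f (g i) = i" "g i \<in> ?V" if "i < N" for i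
    using that range inj_f f_the_inv_into_f[of f ?V i] the_inv_into_into[of f ?V i ?V]
    by (auto simp: g_def)
  have gf: "g (f x) = x" and fN: "f x < N" if "x \<in> ?V" for x
    using that inj_f range by (auto simp: g_def the_inv_into_f_f)
  define p where "p = map g [0..<N]"
  have arc_p: "(x, y) \<in> set (vwalk_arcs p) \<longleftrightarrow> x \<in> ?V \<and> y \<in> ?V \<and> f y = Suc (f x)" for x y
  proof -
    have "(x, y) \<in> set (vwalk_arcs p) \<longleftrightarrow> (\<exists>i. Suc i < N \<and> x = g i \<and> y = g (Suc i))"
      unfolding set_vwalk_arcs_nth mem_Collect_eq
      by (intro iff_exI) (auto simp: p_def)
    also have "\<dots> \<longleftrightarrow> x \<in> ?V \<and> y \<in> ?V \<and> f y = Suc (f x)"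
      using g gf fN by (metis Suc_lessD)
    finally show ?thesis .
  qed
  show thesis
  proof
    have "N > 0" by (simp add: N_def)
    moreover have "distinct p"
      unfolding p_def by (auto simp: distinct_map intro!: inj_on_inverseI[of _ f] g)
    moreover have "set p = ?V"
      unfolding p_def using g gf fN by (force simp: image_iff)
    moreover have "(x, y) \<in> parcs G \<longleftrightarrow> (x, y) \<in> symcl (set (vwalk_arcs p))" for x y
    proof -
      have "(x, y) \<in> symcl (set (vwalk_arcs p)) \<longleftrightarrow>
          (x, y) \<in> set (vwalk_arcs p) \<or> (y, x) \<in> set (vwalk_arcs p)"
        by (auto simp: symcl_def image_iff)
      then show ?thesis
        using arc_iff[of x y] arc_p in_arcsD1 in_arcsD2 by blast
    qed
    ultimately show "traces p G"
      by (auto simp: traces_def p_def)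
    have "f v = 0"
      using gdist_self[OF v] by (simp add: f_def zero_enat_def)
    then show "hd p = v"
      using gf[OF v] \<open>N > 0\<close> by (simp add: p_def hd_map)
  qed
qed

text \<open>
  The vertices that resolve a connected graph on their own: this is the combinatorial content of
  having fractional dimension one.
\<close>

theorem (in pair_graph) inj_gdist_iff_path_graph:
  assumes "Digraph_Component.connected (with_proj G)" "card (pverts G) \<ge> 2" "v \<in> pverts G"
  shows "inj_on (\<lambda>x. gdist G x v) (pverts G) \<longleftrightarrow> path_graph G \<and> end_vertex G v"
proof -
  have "inj_on (\<lambda>x. gdist G x v) (pverts G)" if "traces p G" "hd p = v" for p
  proof (rule inj_onI)
    fix x y assume "x \<in> pverts G" "y \<in> pverts G" "gdist G x v = gdist G y v"
    moreover have "\<exists>i<length p. z = p ! i" if "z \<in> pverts G" for z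
      using that \<open>traces p G\<close> by (auto simp: traces_def in_set_conv_nth)
    ultimately obtain i j where ij: "i < length p" "x = p ! i" "j < length p" "y = p ! j"
        "gdist G (p ! i) v = gdist G (p ! j) v"
      by metis
    then show "x = y"
      using gdist_traces[OF \<open>traces p G\<close>] \<open>hd p = v\<close> by auto
  qed
  then show ?thesis
    unfolding path_graph_end_vertex_iff_traces[OF assms(2)]
    using traces_if_inj_gdist[OF assms(1,3)] by metis
qed

section \<open>Resolving functions of total weight one\<close>

text \<open>
  If two vertices had equal distance to \<open>v\<close>, the set resolving them would miss \<open>v\<close> and could carry at
  most the weight \<open>1 - g v < 1\<close>.
\<close>

lemma inj_gdist_if_total_weight_one:
  assumes g: "resolving_function G g" and fin: "finite (pverts G)"
    and total: "sum g (pverts G) = 1" and v: "v \<in> pverts G" "g v > 0"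
  shows "inj_on (\<lambda>x. gdist G x v) (pverts G)"
proof (rule inj_onI, rule ccontr)
  fix x y
  assume xy: "x \<in> pverts G" "y \<in> pverts G" "gdist G x v = gdist G y v" "x \<noteq> y"
  let ?R = "resolving_nbhd G x y"
  have "?R \<subseteq> pverts G - {v}"
    using xy by (auto simp: resolving_nbhd_def)
  then have "sum g ?R \<le> sum g (pverts G - {v})"
    using fin g by (intro sum_mono2) (auto simp: resolving_function_def Pi_iff)
  also have "\<dots> = 1 - g v"
    using total v fin by (simp add: sum_diff1)
  finally show False
    using g xy v by (force simp: resolving_function_def)
qed

lemma resolving_function_indicator:
  assumes "finite (pverts G)" "v \<in> pverts G" "inj_on (\<lambda>x. gdist G x v) (pverts G)"
  shows "resolving_function G (indicator {v})"
  unfolding resolving_function_def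
proof (intro conjI ballI impI)
  fix x y assume xy: "x \<in> pverts G" "y \<in> pverts G" "x \<noteq> y"
  let ?R = "resolving_nbhd G x y"
  have "v \<in> ?R" "finite ?R"
    using assms xy by (auto simp: resolving_nbhd_def dest: inj_onD)
  then show "sum (indicator {v}) ?R \<ge> (1::real)"
    by (simp add: indicator_def sum.delta)
qed (auto simp: indicator_def)

text \<open>
  Here it matters that one function serves the whole family: a vertex of positive weight is chosen
  before the member of the family. In the other direction, any two distinct vertices of
  any member force the dimension to be at least one.
\<close>

theorem simultaneous_fractional_dim_eq_1_iff:
  assumes fin: "finite V" and card: "card V \<ge> 2" and "\<G> \<noteq> {}"
    and verts: "\<And>G. G \<in> \<G> \<Longrightarrow> pverts G = V"
  shows "simultaneous_fractional_dim V \<G> = 1 \<longleftrightarrow>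
    (\<exists>v\<in>V. \<forall>G\<in>\<G>. inj_on (\<lambda>x. gdist G x v) V)"
proof -
  obtain g where g: "simultaneous_resolving_function V \<G> g"
    and dim: "sum g V = simultaneous_fractional_dim V \<G>"
    and least: "\<And>h. simultaneous_resolving_function V \<G> h \<Longrightarrow>
      simultaneous_fractional_dim V \<G> \<le> sum h V"
    using simultaneous_fractional_dim_is_minimum[OF fin verts] by blast
  show ?thesis
  proof
    assume "simultaneous_fractional_dim V \<G> = 1"
    with dim have total: "sum g V = 1" by simp
    then obtain v where v: "v \<in> V" "g v > 0"
      using sum_nonpos[of V g] by (force simp: not_less[symmetric])
    have "inj_on (\<lambda>x. gdist G x v) V" if "G \<in> \<G>" for G
      using inj_gdist_if_total_weight_one[of G g v] g fin total v verts[OF that] that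
      by (auto simp: simultaneous_resolving_function_def)
    with v show "\<exists>v\<in>V. \<forall>G\<in>\<G>. inj_on (\<lambda>x. gdist G x v) V" by blast
  next
    assume "\<exists>v\<in>V. \<forall>G\<in>\<G>. inj_on (\<lambda>x. gdist G x v) V"
    then obtain v where v: "v \<in> V" and inj: "\<And>G. G \<in> \<G> \<Longrightarrow> inj_on (\<lambda>x. gdist G x v) V"
      by blast
    have "resolving_function G (indicator {v})" if "G \<in> \<G>" for G
      using resolving_function_indicator[of G v] inj[OF that] v fin verts[OF that] by simp
    then have "simultaneous_resolving_function V \<G> (indicator {v})"
      by (simp add: simultaneous_resolving_function_def indicator_def)
    then have "simultaneous_fractional_dim V \<G> \<le> sum (indicator {v}) V"
      by (rule least)
    also have "\<dots> = 1"
      using v fin by (simp add: indicator_def sum.delta)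
    finally have le: "simultaneous_fractional_dim V \<G> \<le> 1" .
    obtain x y where xy: "x \<in> V" "y \<in> V" "x \<noteq> y"
      using card card_le_Suc0_iff_eq[OF fin] by force
    obtain G where G: "G \<in> \<G>" using \<open>\<G> \<noteq> {}\<close> by blast
    have "1 \<le> sum g (resolving_nbhd G x y)"
      using g G xy verts by (auto simp: simultaneous_resolving_function_def resolving_function_def)
    also have "\<dots> \<le> sum g V"
      using g fin verts[OF G]
      by (intro sum_mono2) (auto simp: simultaneous_resolving_function_def resolving_nbhd_def Pi_iff)
    finally show "simultaneous_fractional_dim V \<G> = 1"
      using le dim by simp
  qed
qed

theorem theorem2p5:
  fixes V :: "'a set" and G :: "nat \<Rightarrow> 'a pair_pre_digraph" and k :: nat
  assumes "k \<ge> 2"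
    and "finite V" and "card V \<ge> 3"
    and "\<And>i. i \<in> {1..k} \<Longrightarrow> pair_graph (G i)"
    and "\<And>i. i \<in> {1..k} \<Longrightarrow> pverts (G i) = V"
    and "\<And>i. i \<in> {1..k} \<Longrightarrow> Digraph_Component.connected (with_proj (G i))"
  shows "simultaneous_fractional_dim V (G ` {1..k}) = 1 \<longleftrightarrow>
    (\<forall>i\<in>{1..k}. path_graph (G i)) \<and> (\<exists>u\<in>V. \<forall>i\<in>{1..k}. end_vertex (G i) u)"
proof -
  have "simultaneous_fractional_dim V (G ` {1..k}) = 1 \<longleftrightarrow>
      (\<exists>u\<in>V. \<forall>H\<in>G ` {1..k}. inj_on (\<lambda>x. gdist H x u) V)"
    using assms by (intro simultaneous_fractional_dim_eq_1_iff) auto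
  also have "\<dots> \<longleftrightarrow> (\<exists>u\<in>V. \<forall>i\<in>{1..k}. inj_on (\<lambda>x. gdist (G i) x u) V)"
    by simp
  also have "\<dots> \<longleftrightarrow> (\<exists>u\<in>V. \<forall>i\<in>{1..k}. path_graph (G i) \<and> end_vertex (G i) u)"
  proof (intro bex_cong ball_cong refl)
    fix u i assume "u \<in> V" "i \<in> {1..k}"
    then show "inj_on (\<lambda>x. gdist (G i) x u) V \<longleftrightarrow> path_graph (G i) \<and> end_vertex (G i) u"
      using pair_graph.inj_gdist_iff_path_graph[of "G i" u] assms(3) assms(4-6)[of i] by simp
  qed
  finally show ?thesis
    using assms(3) by blast
qed

end
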